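(* Let $A$ be a C*-algebra and let $A_{\mathrm I},A_{\mathrm{II}},A_{\mathrm{III}},A_{\mathrm{IV}}$ be the annihilators of $A$ defined by $$A_{\mathrm I}=Q_{\mathbf D},\qquad A_{\mathrm{II}}=Q_{\mathbf D}^\perp\cap Q_{\mathbf M},\qquad A_{\mathrm{III}}=Q_{\mathbf M}^\perp\cap Q_{\mathbf O},\qquad A_{\mathrm{IV}}=Q_{\mathbf O}^\perp,$$ where $Q_{\mathbf D},Q_{\mathbf M},Q_{\mathbf O}$ are the central annihilators of $A$ defined in the context. Then $A_{\mathrm I},A_{\mathrm{II}},A_{\mathrm{III}},A_{\mathrm{IV}}$ are (pairwise) orthogonal annihilator ideals of $A$ and $$A_{\mathrm I}\oplus A_{\mathrm{II}}\oplus A_{\mathrm{III}}\oplus A_{\mathrm{IV}}$$ is an essential ideal in $A$.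
   Context: For $a,b\in A$ write $a\perp b$ if $ab=0=ab^*$, and for $S\subseteq A$ put $S^\perp=\{b\in A: s\perp b\text{ for all }s\in S\}$. An annihilator of $A$ is a set of the form $S^\perp$ with $S\subseteq A$; $[A]^\perp$ denotes the set of annihilators. Ordered by inclusion, $[A]^\perp$ is a complete ortholattice: least element $\{0\}$, greatest element $A$, infima are intersections, $\bigvee\mathcal B=(\bigcup\mathcal B)^{\perp\perp}$, orthocomplement $B\mapsto B^\perp$. Two annihilators $B,C$ are orthogonal ($B\perp C$) if $B\subseteq C^\perp$. A subset $T\subseteq A$ is essential in $A$ if $T^{\perp\perp}=A$ (equivalently $T^\perp=\{0\}$). An annihilator ideal is an annihilator that is a (two-sided) ideal of $A$. In an ortholattice, $s,t$ commute if both distributive laws $p\wedge(q\vee r)=(p\wedge q)\vee(p\wedge r)$ and $p\vee(q\wedge r)=(p\vee q)\wedge(p\vee r)$ hold for all $p,q,r\in\{s,s^\perp,t,t^\perp\}$; $p$ is central if it commutes with every element. The central cover of $B\in[A]^\perp$ is $\mathrm c(B)=\bigwedge\{C\in[A]^\perp: C\supseteq B,\ C\text{ central}\}$. For $B\in[A]^\perp$ let $[B]=\{C\in[A]^\perp:C\subseteq B\}$, with the inclusion order (a sublattice of $[A]^\perp$) and the relation $\perp$ inherited from $[A]^\perp$. Let - $\mathbf D$ be the set of $B\in[A]^\perp$ such that $[B]$ is a distributive lattice (both distributive laws hold); - $\mathbf M$ be the set of $B\in[A]^\perp$ such that $[B]$ is modular: $q\le p$ implies $p\wedge(q\vee r)=q\vee(p\wedge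 r)$ for all $p,q,r\in[B]$; - $\mathbf O$ be the set of $B\in[A]^\perp$ such that $[B]$ is orthomodular in the sense that $q\le p$ and $q\perp r$ imply $p\wedge(q\vee r)=q\vee(p\wedge r)$ for all $p,q,r\in[B]$. For $T\in\{\mathbf D,\mathbf M,\mathbf O\}$, $Q_T$ is the unique central element of $[A]^\perp$ such that $Q_T=\mathrm c(B)$ for some $B\in T$ and $\{C\in T:C\subseteq Q_T^\perp\}=\{\{0\}\}$; equivalently, $Q_T=\bigvee\{\mathrm c(B):B\in T\}$. *)

theory Defs
  imports "HOL-Analysis.Analysis"
begin

text \<open>C*-algebras, not necessarily unital (and possibly zero). The library only provides
  real scalars, so complex scalar multiplication is added on top of the real Banach algebra
  structure.\<close>

class cstar_algebra = real_normed_algebra + banach +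
  fixes scaleC :: "complex \<Rightarrow> 'a \<Rightarrow> 'a"  (infixr "*\<^sub>C" 75)
    and adj :: "'a \<Rightarrow> 'a"
  assumes scaleC_add_right: "c *\<^sub>C (x + y) = c *\<^sub>C x + c *\<^sub>C y"
    and scaleC_add_left: "(c + d) *\<^sub>C x = c *\<^sub>C x + d *\<^sub>C x"
    and scaleC_scaleC: "c *\<^sub>C (d *\<^sub>C x) = (c * d) *\<^sub>C x"
    and scaleC_of_real: "complex_of_real r *\<^sub>C x = r *\<^sub>R x"
    and scaleC_mult_left: "(c *\<^sub>C x) * y = c *\<^sub>C (x * y)"
    and scaleC_mult_right: "x * (c *\<^sub>C y) = c *\<^sub>C (x * y)"
    and norm_scaleC: "norm (c *\<^sub>C x) = cmod c * norm x"
    and adj_add: "adj (x + y) = adj x + adj y"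
    and adj_scaleC: "adj (c *\<^sub>C x) = cnj c *\<^sub>C adj x"
    and adj_mult: "adj (x * y) = adj y * adj x"
    and adj_adj: "adj (adj x) = x"
    and cstar_identity: "norm (adj x * x) = (norm x)\<^sup>2"

definition ideal :: "'a::cstar_algebra set \<Rightarrow> bool" where
  "ideal I \<longleftrightarrow> 0 \<in> I \<and> (\<forall>x\<in>I. \<forall>y\<in>I. x + y \<in> I) \<and> (\<forall>c. \<forall>x\<in>I. c *\<^sub>C x \<in> I)
     \<and> (\<forall>a. \<forall>x\<in>I. a * x \<in> I \<and> x * a \<in> I)"

text \<open>This relation on elements is not symmetric in general, so the order of the arguments in
  \<open>ann\<close> matters for sets that are not closed under \<^const>\<open>adj\<close>.\<close>

definition perp :: "'a::cstar_algebra \<Rightarrow> 'a \<Rightarrow> bool" where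
  "perp a b \<longleftrightarrow> a * b = 0 \<and> a * adj b = 0"

definition ann :: "'a::cstar_algebra set \<Rightarrow> 'a set" where
  "ann S = {b. \<forall>s\<in>S. perp s b}"

definition annihilators :: "'a::cstar_algebra set set" where
  "annihilators = range ann"

definition essential :: "'a::cstar_algebra set \<Rightarrow> bool" where
  "essential T \<longleftrightarrow> ann (ann T) = UNIV"

definition annihilator_ideal :: "'a::cstar_algebra set \<Rightarrow> bool" where
  "annihilator_ideal B \<longleftrightarrow> B \<in> annihilators \<and> ideal B"

definition orthogonal_ann :: "'a::cstar_algebra set \<Rightarrow> 'a set \<Rightarrow> bool" where
  "orthogonal_ann B C \<longleftrightarrow> B \<subseteq> ann C"

text \<open>Lattice operations of \<^const>\<open>annihilators\<close>: the order is inclusion, the meet is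
  \<open>\<inter>\<close>, the orthocomplement is \<^const>\<open>ann\<close>, and the join is the following.\<close>

definition ann_join :: "'a::cstar_algebra set \<Rightarrow> 'a set \<Rightarrow> 'a set"  (infixl "\<squnion>\<^sub>a" 65) where
  "B \<squnion>\<^sub>a C = ann (ann (B \<union> C))"

definition ann_commute :: "'a::cstar_algebra set \<Rightarrow> 'a set \<Rightarrow> bool" where
  "ann_commute S T \<longleftrightarrow>
     (\<forall>P \<in> {S, ann S, T, ann T}. \<forall>Q \<in> {S, ann S, T, ann T}. \<forall>R \<in> {S, ann S, T, ann T}.
        P \<inter> (Q \<squnion>\<^sub>a R) = (P \<inter> Q) \<squnion>\<^sub>a (P \<inter> R) \<and>
        P \<squnion>\<^sub>a (Q \<inter> R) = (P \<squnion>\<^sub>a Q) \<inter> (P \<squnion>\<^sub>a R))"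

definition central :: "'a::cstar_algebra set \<Rightarrow> bool" where
  "central B \<longleftrightarrow> B \<in> annihilators \<and> (\<forall>C\<in>annihilators. ann_commute B C)"

definition central_cover :: "'a::cstar_algebra set \<Rightarrow> 'a set" where
  "central_cover B = \<Inter>{C. central C \<and> B \<subseteq> C}"

definition ann_below :: "'a::cstar_algebra set \<Rightarrow> 'a set set" where
  "ann_below B = {C \<in> annihilators. C \<subseteq> B}"

definition distributive_anns :: "'a::cstar_algebra set set" where
  "distributive_anns = {B \<in> annihilators.
     \<forall>P \<in> ann_below B. \<forall>Q \<in> ann_below B. \<forall>R \<in> ann_below B.
       P \<inter> (Q \<squnion>\<^sub>a R) = (P \<inter> Q) \<squnion>\<^sub>a (P \<inter> R) \<and>
       P \<squnion>\<^sub>a (Q \<inter> R) = (P \<squnion>\<^sub>a Q) \<inter> (P \<squnion>\<^sub>a R)}"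

definition modular_anns :: "'a::cstar_algebra set set" where
  "modular_anns = {B \<in> annihilators.
     \<forall>P \<in> ann_below B. \<forall>Q \<in> ann_below B. \<forall>R \<in> ann_below B.
       Q \<subseteq> P \<longrightarrow> P \<inter> (Q \<squnion>\<^sub>a R) = Q \<squnion>\<^sub>a (P \<inter> R)}"

definition orthomodular_anns :: "'a::cstar_algebra set set" where
  "orthomodular_anns = {B \<in> annihilators.
     \<forall>P \<in> ann_below B. \<forall>Q \<in> ann_below B. \<forall>R \<in> ann_below B.
       Q \<subseteq> P \<and> orthogonal_ann Q R \<longrightarrow> P \<inter> (Q \<squnion>\<^sub>a R) = Q \<squnion>\<^sub>a (P \<inter> R)}"

text \<open>The annihilator $Q_T$. It is meant for the three classes above; for an arbitrary \<open>T\<close>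
  the description need not determine a set.\<close>

definition type_ann :: "'a::cstar_algebra set set \<Rightarrow> 'a set" where
  "type_ann T = (THE Q. central Q \<and> (\<exists>B\<in>T. Q = central_cover B) \<and>
     {C \<in> T. C \<subseteq> ann Q} = {{0}})"

end

theory Submission imports Defs begin

text \<open>The decomposition rests on two facts about the ortholattice of annihilators: its central
  elements are exactly the annihilator ideals (\<open>central_iff_annihilator_ideal\<close>), and annihilator
  ideals distribute over arbitrary joins (\<open>ideal_Int_Join\<close>, \<open>Int_Join_ideals\<close>). Both are proved by
  multiplying elements and applying the C*-identity in the form that \<open>x\<^sup>* x = 0\<close> implies \<open>x = 0\<close>.

  By the distributive laws, an inclusion between annihilators can be tested on their intersections
  with a family of ideals whose join contains the smaller one (\<open>subset_by_cuts\<close>). The distributive,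
  modular and orthomodular laws are built from meets, joins and orthogonality, which are compatible
  with such cuts, and so each of the three classes is closed under centrally orthogonal joins
  (\<open>type_determining_local_law\<close>). A maximal centrally orthogonal family in a class \<open>T\<close>,
  given by Zorn's lemma, then yields the central annihilator \<open>Q\<^sub>T\<close>, and cutting the members of \<open>T\<close> by
  \<open>Q\<^sub>T\<^sup>\<perp>\<close> shows that they all lie below \<open>Q\<^sub>T\<close> and that \<open>Q\<^sub>T\<close> is unique (\<open>type_ann_core\<close>).

  A distributive lattice is modular and a modular one is orthomodular, so
  \<open>Q\<^sub>D \<subseteq> Q\<^sub>M \<subseteq> Q\<^sub>O\<close>. The four annihilators of the theorem are the successive differences of this
  chain. As intersections of ideals they are ideals, orthogonality along the chain makes their sum
  direct, and an annihilator orthogonal to all of them meets both \<open>Q\<^sub>M\<close> and \<open>Q\<^sub>M\<^sup>\<perp>\<close> trivially, hence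
  is \<open>{0}\<close>.\<close>

section \<open>Elementary algebra of annihilators\<close>

lemma adj_zero [simp]: "adj (0::'a::cstar_algebra) = 0"
  using adj_add[of "0::'a" 0] by simp

lemma adj_minus: "adj (- x) = - adj (x::'a::cstar_algebra)"
  using adj_add[of x "- x"] by (simp add: eq_neg_iff_add_eq_0 add.commute)

lemma scaleC_zero: "c *\<^sub>C (0::'a::cstar_algebra) = 0"
  using scaleC_add_right[of c "0::'a" 0] by simp

declare adj_adj [simp]

lemma adj_mult_self_eq_0 [simp]: "adj x * x = 0 \<longleftrightarrow> (x::'a::cstar_algebra) = 0"
  using cstar_identity[of x] by auto

lemma mult_adj_self_eq_0 [simp]: "x * adj x = 0 \<longleftrightarrow> (x::'a::cstar_algebra) = 0"
proof -
  have "x * adj x = 0 \<longleftrightarrow> adj x = 0"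
    using adj_mult_self_eq_0[of "adj x"] by simp
  also have "\<dots> \<longleftrightarrow> x = 0"
    by (metis adj_adj adj_zero)
  finally show ?thesis .
qed

text \<open>Positive factors \<open>s\<^sup>* s\<close> can be cancelled to \<open>s\<close>. Most vanishing statements below are
  obtained by first multiplying up to such a factor, which lies in a given annihilator
  even where \<open>s\<close> alone does not.\<close>

lemma adj_mult_self_mult_eq_0 [simp]:
  "adj s * s * b = 0 \<longleftrightarrow> s * (b::'a::cstar_algebra) = 0"
proof
  assume "adj s * s * b = 0"
  then have "adj (s * b) * (s * b) = 0"
    by (simp add: adj_mult mult.assoc)
  then show "s * b = 0"
    using adj_mult_self_eq_0 by blast
qed (simp add: mult.assoc)

lemma mult_mult_adj_self_eq_0 [simp]:
  "b * (s * adj s) = 0 \<longleftrightarrow> b * (s::'a::cstar_algebra) = 0"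
proof
  assume "b * (s * adj s) = 0"
  moreover have "(b * s) * adj (b * s) = b * (s * adj s) * adj b"
    by (simp only: adj_mult mult.assoc)
  ultimately have "(b * s) * adj (b * s) = 0"
    by simp
  then show "b * s = 0"
    using mult_adj_self_eq_0 by blast
qed (simp flip: mult.assoc)

lemma adj_mult_eq_0_iff: "adj a * adj b = 0 \<longleftrightarrow> b * (a::'a::cstar_algebra) = 0"
  by (metis adj_adj adj_mult adj_zero)

lemma mem_ann_iff: "b \<in> ann S \<longleftrightarrow> (\<forall>s\<in>S. s * b = 0 \<and> s * adj b = 0)"
  by (simp add: ann_def perp_def)

lemma ann_antimono: "S \<subseteq> T \<Longrightarrow> ann T \<subseteq> ann S"
  by (auto simp: mem_ann_iff subset_eq)

lemma adj_in_ann: "b \<in> ann S \<Longrightarrow> adj b \<in> ann S"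
  by (simp add: mem_ann_iff)

lemma zero_in_ann: "0 \<in> ann S"
  by (simp add: mem_ann_iff)

lemma add_in_ann: "a \<in> ann S \<Longrightarrow> b \<in> ann S \<Longrightarrow> a + b \<in> ann S"
  by (simp add: mem_ann_iff adj_add distrib_left)

lemma minus_in_ann: "a \<in> ann S \<Longrightarrow> - a \<in> ann S"
  by (simp add: mem_ann_iff adj_minus)

lemma scaleC_in_ann: "a \<in> ann S \<Longrightarrow> c *\<^sub>C a \<in> ann S"
  by (simp add: mem_ann_iff adj_scaleC scaleC_mult_right scaleC_zero)

text \<open>Annihilators are hereditary: a product is absorbed when only its outer factors belong to
  them.\<close>

lemma sandwich_in_ann:
  assumes "b \<in> ann S" "c \<in> ann S"
  shows "b * a * c \<in> ann S"
  unfolding mem_ann_iff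
proof (intro ballI conjI)
  fix s assume "s \<in> S"
  then have "s * b = 0" "s * adj c = 0"
    using assms by (auto simp: mem_ann_iff)
  then show "s * (b * a * c) = 0" "s * adj (b * a * c) = 0"
    by (simp_all add: adj_mult flip: mult.assoc)
qed

lemma mult_in_ann:
  assumes "b \<in> ann S" "c \<in> ann S"
  shows "b * c \<in> ann S"
  unfolding mem_ann_iff
proof (intro ballI conjI)
  fix s assume "s \<in> S"
  then have "s * b = 0" "s * adj c = 0"
    using assms by (auto simp: mem_ann_iff)
  then show "s * (b * c) = 0" "s * adj (b * c) = 0"
    by (simp_all add: adj_mult flip: mult.assoc)
qed

text \<open>On self-adjoint sets the relation \<open>\<perp>\<close> is symmetric, which is what makes \<^const>\<open>ann\<close>
  a Galois connection there.\<close>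

lemma subset_ann_ann:
  assumes "\<And>s. s \<in> S \<Longrightarrow> adj s \<in> S"
  shows "S \<subseteq> ann (ann S)"
proof
  fix s assume "s \<in> S"
  have "b * s = 0 \<and> b * adj s = 0" if "b \<in> ann S" for b
    using that assms[OF \<open>s \<in> S\<close>] \<open>s \<in> S\<close> adj_mult_eq_0_iff[of s b] adj_mult_eq_0_iff[of "adj s" b]
    by (auto simp: mem_ann_iff)
  then show "s \<in> ann (ann S)"
    by (simp add: mem_ann_iff)
qed

text \<open>Elements of \<open>ann S\<close> only see the positive elements \<open>s\<^sup>* s\<close>, so that every annihilator is the
  annihilator of a self-adjoint set even though \<open>S\<close> itself is arbitrary.\<close>

lemma ann_positive_parts: "ann S = ann ((\<lambda>s. adj s * s) ` S)"
  by (auto simp: mem_ann_iff)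

lemma ann_ann_ann: "ann (ann (ann S)) = ann S"
proof -
  let ?S = "(\<lambda>s. adj s * s) ` S"
  have "?S \<subseteq> ann (ann ?S)"
    by (rule subset_ann_ann) (auto simp: adj_mult)
  then have "ann (ann (ann ?S)) \<subseteq> ann ?S"
    by (rule ann_antimono)
  moreover have "ann ?S \<subseteq> ann (ann (ann ?S))"
    by (rule subset_ann_ann) (rule adj_in_ann)
  ultimately have "ann (ann (ann ?S)) = ann ?S"
    by (rule subset_antisym)
  then show ?thesis
    by (simp only: ann_positive_parts[symmetric])
qed

section \<open>The ortholattice of annihilators\<close>

lemma ann_annihilators [simp]: "ann S \<in> annihilators"
  by (simp add: annihilators_def)

lemma ann_ann_annihilator [simp]: "B \<in> annihilators \<Longrightarrow> ann (ann B) = B"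
  by (auto simp: annihilators_def ann_ann_ann)

lemma annihilator_zero: "B \<in> annihilators \<Longrightarrow> 0 \<in> B"
  and annihilator_adj: "B \<in> annihilators \<Longrightarrow> b \<in> B \<Longrightarrow> adj b \<in> B"
  and annihilator_add: "B \<in> annihilators \<Longrightarrow> b \<in> B \<Longrightarrow> c \<in> B \<Longrightarrow> b + c \<in> B"
  and annihilator_minus: "B \<in> annihilators \<Longrightarrow> b \<in> B \<Longrightarrow> - b \<in> B"
  and annihilator_scaleC: "B \<in> annihilators \<Longrightarrow> b \<in> B \<Longrightarrow> z *\<^sub>C b \<in> B"
  and annihilator_mult: "B \<in> annihilators \<Longrightarrow> b \<in> B \<Longrightarrow> c \<in> B \<Longrightarrow> b * c \<in> B"
  and annihilator_sandwich: "B \<in> annihilators \<Longrightarrow> b \<in> B \<Longrightarrow> c \<in> B \<Longrightarrow> b * a * c \<in> B"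
  by (auto simp: annihilators_def zero_in_ann adj_in_ann add_in_ann minus_in_ann scaleC_in_ann
      mult_in_ann sandwich_in_ann)

lemma annihilator_mult_ann:
  assumes "B \<in> annihilators" "b \<in> B" "c \<in> ann B"
  shows "b * c = 0" and "c * b = 0"
proof -
  show "b * c = 0"
    using assms by (simp add: mem_ann_iff)
  have "adj b * adj c = 0"
    using assms annihilator_adj by (auto simp: mem_ann_iff)
  then show "c * b = 0"
    by (simp add: adj_mult_eq_0_iff)
qed

lemma annihilator_Int_ann:
  assumes "B \<in> annihilators"
  shows "B \<inter> ann B = {0}"
proof -
  have "x = 0" if "x \<in> B" "x \<in> ann B" for x
  proof -
    have "x * adj x = 0"
      using that by (simp only: mem_ann_iff)
    then show ?thesis
      by simp
  qed
  then show ?thesis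
    using annihilator_zero[OF assms] zero_in_ann[of B] by blast
qed

lemma ann_zero: "ann {0} = UNIV"
  by (auto simp: mem_ann_iff)

lemma ann_UNIV: "ann (UNIV::'a::cstar_algebra set) = {0}"
  by (auto simp: mem_ann_iff) (metis adj_mult_self_eq_0)

lemma zero_annihilators: "{0} \<in> annihilators"
  by (metis ann_UNIV ann_annihilators)

lemma ann_UN: "ann (\<Union>F) = (\<Inter>B\<in>F. ann B)"
  by (auto simp: mem_ann_iff)

lemma Inter_annihilators:
  assumes "F \<subseteq> annihilators"
  shows "\<Inter>F \<in> annihilators"
proof -
  have "\<Inter>F = (\<Inter>B\<in>F. ann (ann B))"
    using assms by (auto simp: subset_eq)
  also have "\<dots> = ann (\<Union>(ann ` F))"
    by (simp add: ann_UN)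
  finally show ?thesis
    by simp
qed

lemma Int_annihilators: "B \<in> annihilators \<Longrightarrow> C \<in> annihilators \<Longrightarrow> B \<inter> C \<in> annihilators"
  using Inter_annihilators[of "{B, C}"] by simp

definition ann_Join :: "'a::cstar_algebra set set \<Rightarrow> 'a set" where
  "ann_Join F = ann (ann (\<Union>F))"

lemma ann_join_eq_Join: "B \<squnion>\<^sub>a C = ann_Join {B, C}"
  by (simp add: ann_join_def ann_Join_def)

lemma ann_Join_annihilators [simp]: "ann_Join F \<in> annihilators"
  by (simp add: ann_Join_def)

lemma ann_join_annihilators [simp]: "B \<squnion>\<^sub>a C \<in> annihilators"
  by (simp add: ann_join_def)

lemma ann_Join_upper: 
  assumes "F \<subseteq> annihilators" "B \<in> F"
  shows "B \<subseteq> ann_Join F"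
proof -
  have "\<Union>F \<subseteq> ann (ann (\<Union>F))"
    by (rule subset_ann_ann) (use assms(1) annihilator_adj in blast)
  then show ?thesis
    using assms(2) by (auto simp: ann_Join_def)
qed

lemma ann_Join_least:
  assumes "C \<in> annihilators" "\<And>B. B \<in> F \<Longrightarrow> B \<subseteq> C"
  shows "ann_Join F \<subseteq> C"
proof -
  have "ann (ann (\<Union>F)) \<subseteq> ann (ann C)"
    using assms(2) by (intro ann_antimono) blast
  then show ?thesis
    using assms(1) by (simp add: ann_Join_def)
qed

lemma ann_join_upper1: "B \<in> annihilators \<Longrightarrow> C \<in> annihilators \<Longrightarrow> B \<subseteq> B \<squnion>\<^sub>a C"
  and ann_join_upper2: "B \<in> annihilators \<Longrightarrow> C \<in> annihilators \<Longrightarrow> C \<subseteq> B \<squnion>\<^sub>a C"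
  using ann_Join_upper[of "{B, C}"] by (auto simp: ann_join_eq_Join)

lemma ann_join_least: "D \<in> annihilators \<Longrightarrow> B \<subseteq> D \<Longrightarrow> C \<subseteq> D \<Longrightarrow> B \<squnion>\<^sub>a C \<subseteq> D"
  using ann_Join_least[of D "{B, C}"] by (auto simp: ann_join_eq_Join)

lemma ann_join_commute: "B \<squnion>\<^sub>a C = C \<squnion>\<^sub>a B"
  by (simp add: ann_join_def Un_commute)

lemma ann_join_absorb:
  assumes "B \<in> annihilators" "C \<in> annihilators" "C \<subseteq> B"
  shows "B \<squnion>\<^sub>a C = B"
  using assms ann_join_least[of B B C] ann_join_upper1[of B C] by blast

lemma ann_ann_join: "ann (B \<squnion>\<^sub>a C) = ann B \<inter> ann C"
  by (auto simp: ann_join_def ann_ann_ann mem_ann_iff)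

lemma ann_Int:
  assumes "B \<in> annihilators" "C \<in> annihilators"
  shows "ann (B \<inter> C) = ann B \<squnion>\<^sub>a ann C"
proof -
  have "B \<inter> C = ann (ann B \<squnion>\<^sub>a ann C)"
    using assms by (simp add: ann_ann_join)
  then show ?thesis
    by simp
qed

lemma ann_join_ann:
  assumes "B \<in> annihilators"
  shows "B \<squnion>\<^sub>a ann B = UNIV"
proof -
  have "ann B \<squnion>\<^sub>a ann (ann B) = ann (B \<inter> ann B)"
    by (rule ann_Int[OF assms ann_annihilators, symmetric])
  then show ?thesis
    by (simp only: ann_ann_annihilator[OF assms] annihilator_Int_ann[OF assms] ann_zero
        ann_join_commute[of B])
qed

section \<open>Distributivity of annihilator ideals\<close>

lemma annihilator_idealD:
  assumes "annihilator_ideal B"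
  shows "B \<in> annihilators" "b \<in> B \<Longrightarrow> a * b \<in> B" "b \<in> B \<Longrightarrow> b * a \<in> B"
  using assms by (auto simp: annihilator_ideal_def ideal_def)

lemma annihilator_idealI:
  assumes B: "B \<in> annihilators" and l: "\<And>a b. b \<in> B \<Longrightarrow> a * b \<in> B"
  shows "annihilator_ideal B"
proof -
  have "b * a \<in> B" if "b \<in> B" for a b
  proof -
    have "adj (adj a * adj b) \<in> B"
      by (intro annihilator_adj[OF B] l that)
    then show ?thesis
      by (simp add: adj_mult)
  qed
  then show ?thesis
    unfolding annihilator_ideal_def ideal_def
    using B l annihilator_zero[OF B] annihilator_add[OF B] annihilator_scaleC[OF B] by simp
qed

lemma annihilator_ideal_Inter:
  assumes "\<And>B. B \<in> F \<Longrightarrow> annihilator_ideal B"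
  shows "annihilator_ideal (\<Inter>F)"
proof (rule annihilator_idealI)
  show "\<Inter>F \<in> annihilators"
    using assms by (intro Inter_annihilators) (auto simp: annihilator_ideal_def)
  show "a * b \<in> \<Inter>F" if "b \<in> \<Inter>F" for a b
    using that by (meson InterE InterI annihilator_idealD(2) assms)
qed

lemma annihilator_ideal_Int:
  "annihilator_ideal B \<Longrightarrow> annihilator_ideal C \<Longrightarrow> annihilator_ideal (B \<inter> C)"
  using annihilator_ideal_Inter[of "{B, C}"] by auto

lemma annihilator_ideal_ann:
  assumes "annihilator_ideal B"
  shows "annihilator_ideal (ann B)"
proof (rule annihilator_idealI)
  fix a c assume c: "c \<in> ann B"
  have "b * (a * c) = 0 \<and> b * adj (a * c) = 0" if b: "b \<in> B" for b
  proof
    have "(b * a) * c = 0"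
      by (intro annihilator_mult_ann(1)[OF annihilator_idealD(1)[OF assms] _ c]
          annihilator_idealD(3)[OF assms] b)
    then show "b * (a * c) = 0"
      by (simp add: mult.assoc)
    have "b * adj c = 0"
      using b c by (simp add: mem_ann_iff)
    then show "b * adj (a * c) = 0"
      by (simp add: adj_mult flip: mult.assoc)
  qed
  then show "a * c \<in> ann B"
    by (simp add: mem_ann_iff)
qed simp

text \<open>If \<open>d \<perp> C \<inter> B\<close> for an ideal \<open>B\<close>, then \<open>d c b = 0\<close>: the element \<open>c b b\<^sup>* c\<^sup>*\<close>
  lies in \<open>C \<inter> B\<close>, and \<open>d (c b b\<^sup>* c\<^sup>*) d\<^sup>* = (d c b) (d c b)\<^sup>*\<close>.\<close>

lemma ann_Int_ideal_product:
  assumes B: "annihilator_ideal B" and C: "C \<in> annihilators"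
    and d: "d \<in> ann (C \<inter> B)" and c: "c \<in> C" and b: "b \<in> B"
  shows "d * c * b = 0"
proof -
  note BD = annihilator_idealD[OF B]
  have "c * (b * adj b) * adj c \<in> C"
    by (intro annihilator_sandwich[OF C] annihilator_adj[OF C] c)
  moreover have "c * (b * adj b) * adj c \<in> B"
    using BD b by blast
  moreover have "C \<inter> B \<in> annihilators"
    using C BD(1) by (rule Int_annihilators)
  ultimately have "d * (c * (b * adj b) * adj c) = 0"
    by (intro annihilator_mult_ann(2)[OF _ _ d]) auto
  moreover have "(d * c * b) * adj (d * c * b) = d * (c * (b * adj b) * adj c) * adj d"
    by (simp only: adj_mult mult.assoc)
  ultimately have "(d * c * b) * adj (d * c * b) = 0"
    by simp
  then show ?thesis
    using mult_adj_self_eq_0 by blast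
qed

text \<open>An annihilator is not determined by a smaller one with trivial relative complement, since
  the ortholattice need not be orthomodular. Hence joins are always compared by comparing
  their orthocomplements.\<close>

lemma subset_via_ann:
  assumes "X \<in> annihilators" "Y \<in> annihilators"
    and "\<And>d x. d \<in> ann Y \<Longrightarrow> x \<in> X \<Longrightarrow> d * x = 0"
  shows "X \<subseteq> Y"
proof
  fix x assume "x \<in> X"
  then have "\<forall>d\<in>ann Y. d * x = 0 \<and> d * adj x = 0"
    using assms(3) annihilator_adj[OF assms(1)] by blast
  then have "x \<in> ann (ann Y)"
    by (simp only: mem_ann_iff[of _ "ann Y"])
  then show "x \<in> Y"
    using assms(2) by simp
qed

text \<open>Let \<open>d\<close> be orthogonal to all \<open>B \<inter> Q\<close> with \<open>Q\<close> in the family, and let \<open>x \<in> B\<close> lie in the join of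
  the family. The element \<open>y = d\<^sup>* d x\<close> lies in the ideal \<open>B\<close>, so \<open>d q\<^sup>* q y = 0\<close> for \<open>q \<in> Q\<close>, and
  therefore \<open>(q y)\<^sup>* (q y) = (d x)\<^sup>* d q\<^sup>* q y = 0\<close>. Hence \<open>y y\<^sup>*\<close> is orthogonal to the family and so to
  \<open>x\<^sup>*\<close>, which means \<open>x\<^sup>* y = 0\<close>; but \<open>x\<^sup>* y = (d x)\<^sup>* (d x)\<close>.\<close>

lemma ideal_Int_Join:
  assumes B: "annihilator_ideal B" and F: "F \<subseteq> annihilators"
  shows "B \<inter> ann_Join F = ann_Join ((\<inter>) B ` F)"
proof
  note BD = annihilator_idealD[OF B]
  show "ann_Join ((\<inter>) B ` F) \<subseteq> B \<inter> ann_Join F"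
    by (rule ann_Join_least[OF Int_annihilators[OF BD(1) ann_Join_annihilators]])
      (use ann_Join_upper[OF F] in blast)
  show "B \<inter> ann_Join F \<subseteq> ann_Join ((\<inter>) B ` F)"
  proof (rule subset_via_ann)
    show "B \<inter> ann_Join F \<in> annihilators"
      by (rule Int_annihilators[OF BD(1) ann_Join_annihilators])
    fix d x assume "d \<in> ann (ann_Join ((\<inter>) B ` F))" and x: "x \<in> B \<inter> ann_Join F"
    then have d: "d \<in> ann (\<Union>((\<inter>) B ` F))"
      by (simp add: ann_Join_def ann_ann_ann)
    define b where "b = d * x"
    define w where "w = (adj d * b) * adj (adj d * b)"
    have b: "b \<in> B"
      unfolding b_def by (rule BD(2)) (use x in blast)
    have "q * (adj d * b) = 0" if q: "q \<in> Q" "Q \<in> F" for q Q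
    proof -
      have Q: "Q \<in> annihilators"
        using q F by blast
      have "d \<in> ann (Q \<inter> B)"
        using d q by (auto simp: mem_ann_iff)
      moreover have "adj q * q \<in> Q"
        by (intro annihilator_mult[OF Q] annihilator_adj[OF Q] q)
      ultimately have "d * (adj q * q) * (adj d * b) = 0"
        by (intro ann_Int_ideal_product[OF B Q] BD(2) b)
      then have "adj b * (d * (adj q * q) * (adj d * b)) = 0"
        by simp
      then have "adj (q * (adj d * b)) * (q * (adj d * b)) = 0"
        by (simp add: adj_mult mult.assoc)
      then show ?thesis
        using adj_mult_self_eq_0 by blast
    qed
    moreover have "q * w = q * (adj d * b) * adj (adj d * b)" for q
      by (simp only: w_def mult.assoc)
    moreover have "adj w = w"
      by (simp only: w_def adj_mult adj_adj)
    ultimately have "q * w = 0 \<and> q * adj w = 0" if "q \<in> \<Union>F" for q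
      using that by auto
    then have "w \<in> ann (\<Union>F)"
      by (simp add: mem_ann_iff)
    moreover have "adj x \<in> ann (ann (\<Union>F))"
      using x adj_in_ann by (auto simp: ann_Join_def)
    ultimately have "adj x * w = 0"
      by (rule annihilator_mult_ann(2)[OF ann_annihilators])
    then have "adj x * (adj d * b) = 0"
      by (simp only: w_def mult_mult_adj_self_eq_0)
    then have "adj (d * x) * (d * x) = 0"
      unfolding b_def by (simp add: adj_mult mult.assoc)
    then show "d * x = 0"
      using adj_mult_self_eq_0 by blast
  qed simp
qed

lemma ideal_Int_join:
  assumes "annihilator_ideal E" "P \<in> annihilators" "Q \<in> annihilators"
  shows "E \<inter> (P \<squnion>\<^sub>a Q) = (E \<inter> P) \<squnion>\<^sub>a (E \<inter> Q)"
  using ideal_Int_Join[OF assms(1), of "{P, Q}"] assms(2,3) by (simp add: ann_join_eq_Join)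

text \<open>The companion law, where the ideals are the joined elements: if \<open>d \<perp> X \<inter> E\<close> and \<open>x \<in> X\<close>,
  then \<open>d x E = 0\<close> for every \<open>E\<close> in the family. Thus \<open>(d x)\<^sup>* d x\<close> is orthogonal to the whole family,
  and in particular to \<open>x\<close> if \<open>x\<close> lies in its join.\<close>

lemma Int_Join_ideals:
  assumes X: "X \<in> annihilators" and Es: "\<And>E. E \<in> Es \<Longrightarrow> annihilator_ideal E"
  shows "X \<inter> ann_Join Es \<subseteq> ann_Join ((\<inter>) X ` Es)"
proof (rule subset_via_ann)
  show "X \<inter> ann_Join Es \<in> annihilators"
    by (rule Int_annihilators[OF X ann_Join_annihilators])
  fix d x assume "d \<in> ann (ann_Join ((\<inter>) X ` Es))" and x: "x \<in> X \<inter> ann_Join Es"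
  then have d: "d \<in> ann (\<Union>((\<inter>) X ` Es))"
    by (simp add: ann_Join_def ann_ann_ann)
  define v where "v = adj (d * x) * (d * x)"
  have "e * v = 0" if E: "E \<in> Es" and e: "e \<in> E" for e E
  proof -
    have "d \<in> ann (X \<inter> E)"
      using d E by (auto simp: mem_ann_iff)
    moreover have "adj e \<in> E"
      by (rule annihilator_adj[OF annihilator_idealD(1)[OF Es[OF E]] e])
    moreover have "x \<in> X"
      using x by blast
    ultimately have "d * x * adj e = 0"
      by (intro ann_Int_ideal_product[OF Es[OF E] X])
    then have "e * adj (d * x) = 0"
      using adj_mult_eq_0_iff[of "adj (d * x)" e] by simp
    then show ?thesis
      unfolding v_def by (simp flip: mult.assoc)
  qed
  moreover have "adj v = v"
    by (simp only: v_def adj_mult adj_adj)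
  ultimately have "v \<in> ann (\<Union>Es)"
    by (auto simp: mem_ann_iff)
  moreover have "adj x \<in> ann (ann (\<Union>Es))"
    using x adj_in_ann[of x] by (simp add: ann_Join_def)
  ultimately have "v * adj x = 0"
    by (rule annihilator_mult_ann(1)[OF ann_annihilators])
  then have "d * x * adj x = 0"
    by (simp only: v_def adj_mult_self_mult_eq_0)
  then show "d * x = 0"
    by (simp only: mult.assoc mult_mult_adj_self_eq_0)
qed simp

lemma subset_by_cuts:
  assumes "X \<in> annihilators" "Y \<in> annihilators" and Es: "\<And>E. E \<in> Es \<Longrightarrow> annihilator_ideal E"
    and "X \<subseteq> ann_Join Es" and "\<And>E. E \<in> Es \<Longrightarrow> X \<inter> E \<subseteq> Y"
  shows "X \<subseteq> Y"
proof -
  have "X \<subseteq> ann_Join ((\<inter>) X ` Es)"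
    using Int_Join_ideals[OF assms(1) Es] assms(4) by blast
  also have "\<dots> \<subseteq> Y"
    using assms(5) by (intro ann_Join_least[OF assms(2)]) blast
  finally show ?thesis .
qed

lemma subset_by_two_cuts:
  assumes "X \<in> annihilators" "Y \<in> annihilators" and E: "annihilator_ideal E"
    and "X \<inter> E \<subseteq> Y" "X \<inter> ann E \<subseteq> Y"
  shows "X \<subseteq> Y"
proof (rule subset_by_cuts[OF assms(1,2), of "{E, ann E}"])
  show "X \<subseteq> ann_Join {E, ann E}"
    using ann_join_ann[OF annihilator_idealD(1)[OF E]] by (simp add: ann_join_eq_Join)
qed (use assms(4,5) E annihilator_ideal_ann[OF E] in blast)+

lemma Int_join_ideal:
  assumes E: "annihilator_ideal E" and P: "P \<in> annihilators" and R: "R \<in> annihilators"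
  shows "P \<inter> (E \<squnion>\<^sub>a R) \<subseteq> (P \<inter> E) \<squnion>\<^sub>a (P \<inter> R)"
proof (rule subset_by_two_cuts[OF _ _ E])
  note E' = annihilator_idealD(1)[OF E]
  note upper = ann_join_upper1[OF Int_annihilators[OF P E'] Int_annihilators[OF P R]]
    ann_join_upper2[OF Int_annihilators[OF P E'] Int_annihilators[OF P R]]
  show "P \<inter> (E \<squnion>\<^sub>a R) \<in> annihilators"
    by (rule Int_annihilators[OF P ann_join_annihilators])
  show "P \<inter> (E \<squnion>\<^sub>a R) \<inter> E \<subseteq> P \<inter> E \<squnion>\<^sub>a (P \<inter> R)"
    using upper(1) by blast
  have "ann E \<inter> (E \<squnion>\<^sub>a R) = {0} \<squnion>\<^sub>a (ann E \<inter> R)"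
    using ideal_Int_join[OF annihilator_ideal_ann[OF E] E' R] annihilator_Int_ann[OF E']
    by (simp add: Int_commute)
  also have "\<dots> \<subseteq> R"
    by (rule ann_join_least[OF R]) (use annihilator_zero[OF R] in auto)
  finally show "P \<inter> (E \<squnion>\<^sub>a R) \<inter> ann E \<subseteq> P \<inter> E \<squnion>\<^sub>a (P \<inter> R)"
    using upper(2) by blast
qed simp

section \<open>Central annihilators are the annihilator ideals\<close>

lemma ideal_distributive:
  assumes E: "annihilator_ideal E" and C: "C \<in> annihilators"
    and P: "P \<in> {E, ann E, C, ann C}" and Q: "Q \<in> {E, ann E, C, ann C}"
    and R: "R \<in> {E, ann E, C, ann C}"
  shows "P \<inter> (Q \<squnion>\<^sub>a R) = (P \<inter> Q) \<squnion>\<^sub>a (P \<inter> R)"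
proof
  have anns: "P \<in> annihilators" "Q \<in> annihilators" "R \<in> annihilators"
    using P Q R C annihilator_idealD(1)[OF E] by auto
  note PQ = Int_annihilators[OF anns(1,2)] and PR = Int_annihilators[OF anns(1,3)]
  show "(P \<inter> Q) \<squnion>\<^sub>a (P \<inter> R) \<subseteq> P \<inter> (Q \<squnion>\<^sub>a R)"
    by (rule ann_join_least[OF Int_annihilators[OF anns(1) ann_join_annihilators]])
      (use ann_join_upper1[OF anns(2,3)] ann_join_upper2[OF anns(2,3)] in auto)
  note E' = annihilator_ideal_ann[OF E]
  \<comment> \<open>If no ideal is involved, two of the three annihilators coincide.\<close>
  consider "annihilator_ideal P" | "annihilator_ideal Q" | "annihilator_ideal R"
    | "P = Q" | "P = R" | "Q = R"
    using P Q R E E' by auto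
  then show "P \<inter> (Q \<squnion>\<^sub>a R) \<subseteq> (P \<inter> Q) \<squnion>\<^sub>a (P \<inter> R)"
  proof cases
    case 1
    then show ?thesis
      using ideal_Int_join[OF _ anns(2,3)] by simp
  next
    case 2
    then show ?thesis
      by (rule Int_join_ideal[OF _ anns(1,3)])
  next
    case 3
    then have "P \<inter> (R \<squnion>\<^sub>a Q) \<subseteq> (P \<inter> R) \<squnion>\<^sub>a (P \<inter> Q)"
      by (rule Int_join_ideal[OF _ anns(1,2)])
    then show ?thesis
      by (simp only: ann_join_commute)
  next
    case 4
    then show ?thesis
      using ann_join_upper1[OF PQ PR] by blast
  next
    case 5
    then show ?thesis
      using ann_join_upper2[OF PQ PR] by blast
  next
    case 6
    then show ?thesis
      using ann_join_absorb[OF anns(2,2)] ann_join_upper1[OF PQ PR] by blast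
  qed
qed

lemma annihilator_ideal_imp_central:
  assumes E: "annihilator_ideal E"
  shows "central E"
proof -
  note E' = annihilator_idealD(1)[OF E]
  have "ann_commute E C" if C: "C \<in> annihilators" for C
    unfolding ann_commute_def
  proof (intro ballI conjI)
    let ?S = "{E, ann E, C, ann C}"
    fix P Q R assume S: "P \<in> ?S" "Q \<in> ?S" "R \<in> ?S"
    then show "P \<inter> (Q \<squnion>\<^sub>a R) = (P \<inter> Q) \<squnion>\<^sub>a (P \<inter> R)"
      by (rule ideal_distributive[OF E C])
    have anns: "P \<in> annihilators" "Q \<in> annihilators" "R \<in> annihilators"
      using S C E' by auto
    have S_ann: "ann X \<in> ?S" if "X \<in> ?S" for X
      using that ann_ann_annihilator[OF C] ann_ann_annihilator[OF E'] by (elim insertE) simp_all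
    have "ann P \<inter> (ann Q \<squnion>\<^sub>a ann R) = (ann P \<inter> ann Q) \<squnion>\<^sub>a (ann P \<inter> ann R)"
      by (rule ideal_distributive[OF E C S_ann[OF S(1)] S_ann[OF S(2)] S_ann[OF S(3)]])
    then have "ann (ann P \<inter> (ann Q \<squnion>\<^sub>a ann R)) = ann ((ann P \<inter> ann Q) \<squnion>\<^sub>a (ann P \<inter> ann R))"
      by simp
    then show "P \<squnion>\<^sub>a (Q \<inter> R) = (P \<squnion>\<^sub>a Q) \<inter> (P \<squnion>\<^sub>a R)"
      using anns by (simp add: ann_Int Int_annihilators ann_ann_join)
  qed
  then show ?thesis
    using E' by (simp add: central_def)
qed

text \<open>Why the corner \<open>B A B\<^sup>\<perp>\<close> of a central \<open>B\<close> vanishes. For \<open>x \<in> B A B\<^sup>\<perp>\<close>, written as a matrix with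
  respect to the supports of \<open>B\<^sup>\<perp>\<close> and \<open>B\<close>, the element \<open>y = x + x\<^sup>* x\<close> is a column with entries
  \<open>x\<^sup>* x\<close> and \<open>x\<close>, so its range lies on the graph of an injective operator between the two supports.
  The element \<open>z = x x\<^sup>* - x\<^sup>*\<close> is the column of the orthogonal graph, and \<open>y\<^sup>* z = 0\<close>. A graph of this
  kind meets both coordinate spaces trivially, and accordingly the annihilator \<open>C\<close>
  generated by \<open>y y\<^sup>*\<close> meets \<open>B\<close> and \<open>B\<^sup>\<perp>\<close> in \<open>{0}\<close>: every \<open>p \<in> C\<close> satisfies \<open>z\<^sup>* p = 0\<close>, that is
  \<open>x x\<^sup>* p = x p\<close>, and for \<open>p\<close> in \<open>B\<close> or \<open>B\<^sup>\<perp>\<close> one of \<open>x p\<close>, \<open>x\<^sup>* p\<close> vanishes; then so does the other,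
  and \<open>y\<^sup>* p = 0\<close> puts \<open>p\<close> into \<open>C \<inter> C\<^sup>\<perp>\<close>. As \<open>B\<close> commutes with \<open>C\<close>, this forces \<open>C = {0}\<close>, so that
  \<open>y = 0\<close> and \<open>x = 0\<close>.\<close>

lemma central_corner_zero:
  assumes B: "central B" and b: "b \<in> B" and c: "c \<in> ann B"
  shows "b * a * c = (0::'a::cstar_algebra)"
proof -
  have BA: "B \<in> annihilators"
    using B by (simp add: central_def)
  define x where "x = b * a * c"
  define y where "y = x + adj x * x"
  define z where "z = x * adj x - adj x"
  have xB: "x * p = 0" "adj p * adj x = 0" if "p \<in> B" for p
  proof -
    have "c * p = 0"
      by (rule annihilator_mult_ann(2)[OF BA that c])
    then show "x * p = 0"
      by (simp add: x_def mult.assoc)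
    then show "adj p * adj x = 0"
      by (simp add: adj_mult_eq_0_iff)
  qed
  have xB': "adj x * p = 0" if "p \<in> ann B" for p
  proof -
    have "adj b * p = 0"
      by (rule annihilator_mult_ann(1)[OF BA annihilator_adj[OF BA b] that])
    then show ?thesis
      by (simp add: x_def adj_mult mult.assoc)
  qed
  have "c * b = 0"
    by (rule annihilator_mult_ann(2)[OF BA b c])
  then have cbr: "c * (b * r) = 0" for r
    by (simp flip: mult.assoc)
  have xx: "x * x = 0"
    unfolding x_def by (simp add: mult.assoc cbr)
  have xx': "adj x * adj x = 0"
    using xx by (simp add: adj_mult_eq_0_iff)
  have adj_y: "adj y = adj x + adj x * x"
    by (simp add: y_def adj_add adj_mult)
  have adj_z: "adj z = x * adj x - x"
    unfolding z_def diff_conv_add_uminus by (simp only: adj_add adj_minus adj_mult adj_adj)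
  have yz: "adj y * z = 0"
  proof -
    have "x * (x * r) = 0" "adj x * (adj x * r) = 0" for r
      using xx xx' by (simp_all flip: mult.assoc)
    then show ?thesis
      using xx xx' unfolding adj_y z_def
      by (simp add: algebra_simps)
  qed
  define C where "C = ann (ann {y * adj y})"
  have C: "C \<in> annihilators"
    by (simp add: C_def)
  have z_ann: "z * adj z \<in> ann {y * adj y}"
  proof -
    have "y * adj y * (z * adj z) = y * (adj y * z) * adj z"
      by (simp only: mult.assoc)
    then show ?thesis
      using yz by (simp add: mem_ann_iff adj_mult)
  qed
  have zC: "adj z * p = 0" if "p \<in> C" for p
  proof -
    have "z * adj z * p = 0"
      using that z_ann by (simp add: C_def mem_ann_iff[of _ "ann {y * adj y}"])
    then show ?thesis
      using adj_mult_self_mult_eq_0[of "adj z" p] by simp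
  qed
  have trivial: "p = 0" if p: "p \<in> C" and x: "x * p = 0 \<or> adj x * p = 0"
    and x': "x * adj p = 0 \<or> adj x * adj p = 0" for p
  proof -
    have *: "adj y * q = 0" if q: "q \<in> C" and x: "x * q = 0 \<or> adj x * q = 0" for q
    proof -
      have eq: "x * (adj x * q) = x * q"
        using zC[OF q] by (simp add: adj_z algebra_simps)
      have "x * q = 0"
        using x eq by auto
      moreover have "adj x * q = 0"
        using eq \<open>x * q = 0\<close> adj_mult_self_mult_eq_0[of "adj x" q] by (simp add: mult.assoc)
      ultimately show ?thesis
        by (simp add: adj_y distrib_right mult.assoc)
    qed
    have "p \<in> ann {y * adj y}"
      using *[OF p x] *[OF annihilator_adj[OF C p] x'] by (simp add: mem_ann_iff mult.assoc)
    then show "p = 0"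
      using p annihilator_Int_ann[OF ann_annihilators[of "{y * adj y}"]] unfolding C_def by blast
  qed
  have "C \<inter> B = {0}"
    using trivial xB(1) annihilator_adj[OF BA] annihilator_zero[OF C] annihilator_zero[OF BA] by auto
  moreover have "C \<inter> ann B = {0}"
    using trivial xB' adj_in_ann[of _ B] annihilator_zero[OF C] zero_in_ann[of B] by auto
  moreover have "C \<inter> (B \<squnion>\<^sub>a ann B) = (C \<inter> B) \<squnion>\<^sub>a (C \<inter> ann B)"
    using B C by (simp add: central_def ann_commute_def)
  ultimately have "C = {0} \<squnion>\<^sub>a {0}"
    by (simp add: ann_join_ann[OF BA])
  then have "C = {0}"
    using ann_join_absorb[OF zero_annihilators zero_annihilators] by simp
  moreover have "{y * adj y} \<subseteq> C"
    unfolding C_def by (rule subset_ann_ann) (simp add: adj_mult)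
  ultimately have "y * adj y = 0"
    by blast
  then have "y = 0"
    by (simp only: mult_adj_self_eq_0)
  then have "adj x * y = 0"
    by simp
  moreover have "adj x * y = adj x * x"
    using xx' by (simp add: y_def distrib_left flip: mult.assoc)
  ultimately have "x = 0"
    by simp
  then show ?thesis
    by (simp add: x_def)
qed

lemma central_imp_annihilator_ideal:
  assumes B: "central B"
  shows "annihilator_ideal B"
proof (rule annihilator_idealI)
  show BA: "B \<in> annihilators"
    using B by (simp add: central_def)
  fix a b assume b: "b \<in> B"
  have "c * (a * b) = 0 \<and> c * adj (a * b) = 0" if c: "c \<in> ann B" for c
  proof
    have "adj b * adj a * adj c = 0"
      by (rule central_corner_zero[OF B annihilator_adj[OF BA b] adj_in_ann[OF c]])
    then have "adj (a * b) * adj c = 0"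
      by (simp only: adj_mult)
    then show "c * (a * b) = 0"
      by (simp only: adj_mult_eq_0_iff)
    have "c * adj b = 0"
      by (rule annihilator_mult_ann(2)[OF BA annihilator_adj[OF BA b] c])
    then show "c * adj (a * b) = 0"
      by (simp add: adj_mult flip: mult.assoc)
  qed
  then have "a * b \<in> ann (ann B)"
    by (simp add: mem_ann_iff[of _ "ann B"])
  then show "a * b \<in> B"
    using BA by simp
qed

lemma central_iff_annihilator_ideal: "central B \<longleftrightarrow> annihilator_ideal B"
  using annihilator_ideal_imp_central central_imp_annihilator_ideal by blast

section \<open>Type-determining classes\<close>

lemma central_cover_ideal: "annihilator_ideal (central_cover B)"
  unfolding central_cover_def
  by (rule annihilator_ideal_Inter) (simp add: central_iff_annihilator_ideal)

lemma central_cover_upper: "B \<subseteq> central_cover B"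
  unfolding central_cover_def by blast

lemma central_cover_least: "annihilator_ideal C \<Longrightarrow> B \<subseteq> C \<Longrightarrow> central_cover B \<subseteq> C"
  unfolding central_cover_def central_iff_annihilator_ideal by blast

text \<open>Two closure properties that make \<^const>\<open>type_ann\<close> well defined: the first gives uniqueness, the
  second existence. The family of joined annihilators may be empty, so that \<open>{0}\<close> always belongs to
  the class.\<close>

definition type_determining :: "'a::cstar_algebra set set \<Rightarrow> bool" where
  "type_determining T \<longleftrightarrow> T \<subseteq> annihilators
     \<and> (\<forall>B\<in>T. \<forall>C\<in>annihilators. C \<subseteq> B \<longrightarrow> C \<in> T)
     \<and> (\<forall>F\<subseteq>T. pairwise (\<lambda>B C. central_cover B \<subseteq> ann (central_cover C)) F \<longrightarrow> ann_Join F \<in> T)"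

lemma ann_Join_empty: "ann_Join {} = {0}"
proof -
  have "ann {} = (UNIV :: 'a set)"
    by (simp add: ann_def)
  then show ?thesis
    by (simp add: ann_Join_def ann_UNIV)
qed

lemma type_determining_zero: "type_determining T \<Longrightarrow> {0} \<in> T"
  unfolding type_determining_def using ann_Join_empty pairwise_empty empty_subsetI by metis

text \<open>The cut of a member by \<open>Q\<^sup>\<perp>\<close> is again a member and lies below \<open>Q\<^sup>\<perp>\<close>, so it is \<open>{0}\<close>. Applied
  to two candidates for \<^const>\<open>type_ann\<close>, this also shows that they contain each other.\<close>

lemma type_determining_below_core:
  assumes T: "type_determining T" and Q: "annihilator_ideal Q"
    and core: "{C \<in> T. C \<subseteq> ann Q} = {{0}}" and B: "B \<in> T"
  shows "B \<subseteq> Q"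
proof (rule subset_by_two_cuts[OF _ _ Q])
  note QA = annihilator_idealD(1)[OF Q]
  show BA: "B \<in> annihilators"
    using T B by (auto simp: type_determining_def)
  have "B \<inter> ann Q \<in> annihilators"
    by (rule Int_annihilators[OF BA ann_annihilators])
  then have "B \<inter> ann Q \<in> T"
    using T B by (simp add: type_determining_def)
  then have "B \<inter> ann Q \<in> {C \<in> T. C \<subseteq> ann Q}"
    by simp
  then have "B \<inter> ann Q = {0}"
    unfolding core by simp
  then show "B \<inter> ann Q \<subseteq> Q"
    using annihilator_zero[OF QA] by simp
qed (use annihilator_idealD(1)[OF Q] in auto)

text \<open>The central annihilator of a class is the central cover of the join of a maximal family of
  nonzero, centrally orthogonal members: a further member below its complement could be added to
  the family.\<close>

lemma type_determining_core_exists: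
  assumes T: "type_determining T"
  shows "\<exists>Q. central Q \<and> (\<exists>B\<in>T. Q = central_cover B) \<and> {C \<in> T. C \<subseteq> ann Q} = {{0}}"
proof -
  have TA: "T \<subseteq> annihilators"
    using T by (simp add: type_determining_def)
  define r where "r = (\<lambda>B C :: 'a set. central_cover B \<subseteq> ann (central_cover C))"
  define \<A> where "\<A> = {F. F \<subseteq> T - {{0}} \<and> pairwise r F}"
  have "\<exists>M\<in>\<A>. \<forall>X\<in>\<A>. M \<subseteq> X \<longrightarrow> X = M"
  proof (rule subset_Zorn_nonempty)
    show "\<A> \<noteq> {}"
      unfolding \<A>_def using pairwise_empty by blast
    fix \<C> assume ch: "subset.chain \<A> \<C>"
    then have sub: "\<C> \<subseteq> \<A>" and "chain\<^sub>\<subseteq> \<C>"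
      by (auto simp: subset.chain_def chain_subset_def)
    then have "pairwise r (\<Union>\<C>)"
      by (intro pairwise_chain_Union) (auto simp: \<A>_def)
    moreover have "\<Union>\<C> \<subseteq> T - {{0}}"
      using sub unfolding \<A>_def by blast
    ultimately show "\<Union>\<C> \<in> \<A>"
      by (simp add: \<A>_def)
  qed
  then obtain M where M: "M \<in> \<A>" and max: "\<And>X. X \<in> \<A> \<Longrightarrow> M \<subseteq> X \<Longrightarrow> X = M"
    by blast
  have MT: "M \<subseteq> T" and pw: "pairwise r M"
    using M by (auto simp: \<A>_def)
  define B where "B = ann_Join M"
  define Q where "Q = central_cover B"
  have Q: "annihilator_ideal Q"
    unfolding Q_def by (rule central_cover_ideal)
  note QA = annihilator_idealD(1)[OF Q]
  have B: "B \<in> T"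
    using T MT pw unfolding type_determining_def r_def B_def by blast
  have MB: "C \<subseteq> Q" if "C \<in> M" for C
  proof -
    have "C \<subseteq> B"
      unfolding B_def by (rule ann_Join_upper) (use MT TA that in auto)
    then show ?thesis
      using central_cover_upper[of B] unfolding Q_def by simp
  qed
  have "C = {0}" if C: "C \<in> T" and CQ: "C \<subseteq> ann Q" for C
  proof (rule ccontr)
    assume "C \<noteq> {0}"
    have cC: "central_cover C \<subseteq> ann Q"
      by (rule central_cover_least[OF annihilator_ideal_ann[OF Q] CQ])
    have "r C D \<and> r D C" if "D \<in> M" for D
    proof -
      have cD: "central_cover D \<subseteq> Q"
        by (rule central_cover_least[OF Q MB[OF that]])
      have "Q \<subseteq> ann (central_cover C)"
        using ann_antimono[OF cC] QA by simp
      then show ?thesis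
        using cC cD ann_antimono[OF cD] unfolding r_def by blast
    qed
    then have "pairwise r (insert C M)"
      using pw by (simp add: pairwise_insert)
    then have "insert C M \<in> \<A>"
      using M C \<open>C \<noteq> {0}\<close> by (simp add: \<A>_def)
    then have "C \<in> M"
      using max[of "insert C M"] by blast
    then have "C \<subseteq> Q \<inter> ann Q"
      using MB CQ by blast
    then have "C \<subseteq> {0}"
      using annihilator_Int_ann[OF QA] by simp
    moreover have "0 \<in> C"
      using annihilator_zero C TA by blast
    ultimately show False
      using \<open>C \<noteq> {0}\<close> by blast
  qed
  then have "{C \<in> T. C \<subseteq> ann Q} = {{0}}"
    using type_determining_zero[OF T] zero_in_ann[of Q] by blast
  moreover have "central Q"
    using Q by (simp add: central_iff_annihilator_ideal)
  ultimately show ?thesis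
    using B Q_def by blast
qed

lemma type_ann_core:
  assumes T: "type_determining T"
  shows "central (type_ann T) \<and> (\<exists>B\<in>T. type_ann T = central_cover B)
    \<and> {C \<in> T. C \<subseteq> ann (type_ann T)} = {{0}}"
  unfolding type_ann_def
proof (rule theI')
  have "Q \<subseteq> Q'"
    if "\<exists>B\<in>T. Q = central_cover B" and "central Q'" "{C \<in> T. C \<subseteq> ann Q'} = {{0}}" for Q Q'
    using type_determining_below_core[OF T _ that(3)] that(1,2) central_cover_least[of Q']
    unfolding central_iff_annihilator_ideal by blast
  then show "\<exists>!Q. central Q \<and> (\<exists>B\<in>T. Q = central_cover B) \<and> {C \<in> T. C \<subseteq> ann Q} = {{0}}"
    using type_determining_core_exists[OF T] by (intro ex_ex1I) (blast, meson subset_antisym)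
qed

lemma type_ann_ideal: "type_determining T \<Longrightarrow> annihilator_ideal (type_ann T)"
  using type_ann_core[of T] central_imp_annihilator_ideal by blast

lemma type_ann_mono:
  assumes S: "type_determining S" and T: "type_determining T" and "S \<subseteq> T"
  shows "type_ann S \<subseteq> type_ann T"
proof -
  obtain B where "B \<in> S" and B: "type_ann S = central_cover B"
    using type_ann_core[OF S] by blast
  have "{C \<in> T. C \<subseteq> ann (type_ann T)} = {{0}}"
    using type_ann_core[OF T] by (elim conjE)
  then have "B \<subseteq> type_ann T"
    by (rule type_determining_below_core[OF T type_ann_ideal[OF T]])
      (use \<open>B \<in> S\<close> assms(3) in blast)
  then show ?thesis
    unfolding B by (rule central_cover_least[OF type_ann_ideal[OF T]])
qed

section \<open>Distributive, modular and orthomodular annihilators\<close>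

text \<open>A law that can be tested on the cuts by a covering family of ideals defines a
  type-determining class: the central covers of a centrally orthogonal family cover its join,
  and they cut each member out of the join again.\<close>

lemma type_determining_local_law:
  assumes "\<And>Es P Q R. P \<in> annihilators \<Longrightarrow> Q \<in> annihilators \<Longrightarrow> R \<in> annihilators \<Longrightarrow>
      P \<subseteq> ann_Join Es \<Longrightarrow> Q \<subseteq> ann_Join Es \<Longrightarrow> R \<subseteq> ann_Join Es \<Longrightarrow>
      (\<And>E. E \<in> Es \<Longrightarrow> annihilator_ideal E) \<Longrightarrow>
      (\<And>E. E \<in> Es \<Longrightarrow> law (E \<inter> P) (E \<inter> Q) (E \<inter> R)) \<Longrightarrow> law P Q R"
  shows "type_determining
    {B \<in> annihilators. \<forall>P\<in>ann_below B. \<forall>Q\<in>ann_below B. \<forall>R\<in>ann_below B. law P Q R}"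
    (is "type_determining ?T")
  unfolding type_determining_def
proof (intro conjI allI impI ballI)
  show "?T \<subseteq> annihilators"
    by blast
  show "C \<in> ?T" if "B \<in> ?T" "C \<in> annihilators" "C \<subseteq> B" for B C
  proof -
    have "ann_below C \<subseteq> ann_below B"
      using that(3) by (auto simp: ann_below_def)
    then show ?thesis
      using that(1,2) by blast
  qed
  fix F assume F: "F \<subseteq> ?T"
    and pw: "pairwise (\<lambda>B C. central_cover B \<subseteq> ann (central_cover C)) F"
  then have FA: "F \<subseteq> annihilators"
    by blast
  have cut: "central_cover B \<inter> ann_Join F \<subseteq> B" if B: "B \<in> F" for B
    unfolding ideal_Int_Join[OF central_cover_ideal FA]
  proof (rule ann_Join_least)
    show BA: "B \<in> annihilators"
      using B FA by blast
    fix X assume "X \<in> (\<inter>) (central_cover B) ` F"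
    then obtain C where C: "C \<in> F" and X: "X = central_cover B \<inter> C"
      by blast
    show "X \<subseteq> B"
    proof (cases "C = B")
      case False
      then have "central_cover C \<subseteq> ann (central_cover B)"
        using pw B C by (auto simp: pairwise_def)
      then have "X \<subseteq> central_cover B \<inter> ann (central_cover B)"
        using central_cover_upper[of C] X by blast
      then show ?thesis
        using annihilator_Int_ann[OF annihilator_idealD(1)[OF central_cover_ideal, of B]]
          annihilator_zero[OF BA] by auto
    qed (use X in blast)
  qed
  define Es where "Es = central_cover ` F"
  have EsI: "annihilator_ideal E" if "E \<in> Es" for E
    using that central_cover_ideal by (auto simp: Es_def)
  have "ann_Join F \<subseteq> ann_Join Es"
  proof (rule ann_Join_least)
    fix B assume "B \<in> F"
    then have "central_cover B \<subseteq> ann_Join Es"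
      by (intro ann_Join_upper) (use EsI annihilator_idealD(1) in \<open>auto simp: Es_def\<close>)
    then show "B \<subseteq> ann_Join Es"
      using central_cover_upper[of B] by blast
  qed simp
  then have below: "P \<subseteq> ann_Join Es" if "P \<in> ann_below (ann_Join F)" for P
    using that by (auto simp: ann_below_def)
  have "law P Q R" if PQR: "P \<in> ann_below (ann_Join F)" "Q \<in> ann_below (ann_Join F)"
      "R \<in> ann_below (ann_Join F)" for P Q R
  proof (rule assms[of _ _ _ Es])
    fix E assume "E \<in> Es"
    then obtain B where B: "B \<in> F" and E: "E = central_cover B"
      by (auto simp: Es_def)
    have "E \<inter> X \<in> ann_below B" if "X \<in> ann_below (ann_Join F)" for X
      using that cut[OF B] Int_annihilators[OF annihilator_idealD(1)[OF central_cover_ideal], of X B]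
      unfolding E ann_below_def by blast
    then have "E \<inter> P \<in> ann_below B" "E \<inter> Q \<in> ann_below B" "E \<inter> R \<in> ann_below B"
      using PQR by simp_all
    moreover have "B \<in> ?T"
      using F B by blast
    ultimately show "law (E \<inter> P) (E \<inter> Q) (E \<inter> R)"
      by blast
  qed (use PQR below EsI in \<open>simp_all add: ann_below_def\<close>)
  then show "ann_Join F \<in> ?T"
    by simp
qed

lemma eq_by_cuts:
  assumes "X \<in> annihilators" "Y \<in> annihilators" and "\<And>E. E \<in> Es \<Longrightarrow> annihilator_ideal E"
    and "X \<subseteq> ann_Join Es" "Y \<subseteq> ann_Join Es" and eq: "\<And>E. E \<in> Es \<Longrightarrow> E \<inter> X = E \<inter> Y"
  shows "X = Y"
proof
  show "X \<subseteq> Y"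
    by (rule subset_by_cuts[OF assms(1,2,3,4)]) (use eq in blast)+
  show "Y \<subseteq> X"
    by (rule subset_by_cuts[OF assms(2,1,3,5)]) (use eq in blast)+
qed

lemma type_determining_distributive: "type_determining distributive_anns"
  unfolding distributive_anns_def
proof (rule type_determining_local_law)
  fix Es and P Q R :: "'a set"
  assume A: "P \<in> annihilators" "Q \<in> annihilators" "R \<in> annihilators"
    and S: "P \<subseteq> ann_Join Es" "Q \<subseteq> ann_Join Es" "R \<subseteq> ann_Join Es"
    and Es: "\<And>E. E \<in> Es \<Longrightarrow> annihilator_ideal E"
    and law: "\<And>E. E \<in> Es \<Longrightarrow>
      (E \<inter> P) \<inter> ((E \<inter> Q) \<squnion>\<^sub>a (E \<inter> R)) = (E \<inter> P \<inter> (E \<inter> Q)) \<squnion>\<^sub>a (E \<inter> P \<inter> (E \<inter> R)) \<and>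
      (E \<inter> P) \<squnion>\<^sub>a ((E \<inter> Q) \<inter> (E \<inter> R)) = ((E \<inter> P) \<squnion>\<^sub>a (E \<inter> Q)) \<inter> ((E \<inter> P) \<squnion>\<^sub>a (E \<inter> R))"
  have dist: "E \<inter> (X \<inter> Y) = (E \<inter> X) \<inter> (E \<inter> Y)" for E X Y :: "'a set"
    by blast
  show "P \<inter> (Q \<squnion>\<^sub>a R) = (P \<inter> Q) \<squnion>\<^sub>a (P \<inter> R) \<and> P \<squnion>\<^sub>a (Q \<inter> R) = (P \<squnion>\<^sub>a Q) \<inter> (P \<squnion>\<^sub>a R)"
  proof
    show "P \<inter> (Q \<squnion>\<^sub>a R) = (P \<inter> Q) \<squnion>\<^sub>a (P \<inter> R)"
    proof (rule eq_by_cuts[OF _ _ Es])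
      show "P \<inter> Q \<squnion>\<^sub>a (P \<inter> R) \<subseteq> ann_Join Es"
        by (rule ann_join_least) (use S in auto)
      show "E \<inter> (P \<inter> (Q \<squnion>\<^sub>a R)) = E \<inter> (P \<inter> Q \<squnion>\<^sub>a (P \<inter> R))" if "E \<in> Es" for E
        using law[OF that] Es[OF that] A
        by (simp add: ideal_Int_join Int_annihilators dist[of E P])
    qed (use A S in \<open>auto intro!: Int_annihilators\<close>)
    show "P \<squnion>\<^sub>a (Q \<inter> R) = (P \<squnion>\<^sub>a Q) \<inter> (P \<squnion>\<^sub>a R)"
    proof (rule eq_by_cuts[OF _ _ Es])
      have "P \<squnion>\<^sub>a Q \<subseteq> ann_Join Es"
        by (rule ann_join_least) (use S in auto)
      then show "(P \<squnion>\<^sub>a Q) \<inter> (P \<squnion>\<^sub>a R) \<subseteq> ann_Join Es"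
        by blast
      show "P \<squnion>\<^sub>a (Q \<inter> R) \<subseteq> ann_Join Es"
        by (rule ann_join_least) (use S in auto)
      show "E \<inter> (P \<squnion>\<^sub>a (Q \<inter> R)) = E \<inter> ((P \<squnion>\<^sub>a Q) \<inter> (P \<squnion>\<^sub>a R))" if "E \<in> Es" for E
        using law[OF that] Es[OF that] A
        by (simp add: ideal_Int_join Int_annihilators dist[of E Q R] dist[of E "P \<squnion>\<^sub>a Q"])
    qed (use A in \<open>auto intro!: Int_annihilators\<close>)
  qed
qed

text \<open>The common part of the modular and the orthomodular case, which differ only in the hypotheses
  under which the equation is required.\<close>

lemma modular_law_local:
  assumes A: "P \<in> annihilators" "Q \<in> annihilators" "R \<in> annihilators"
    and S: "P \<subseteq> ann_Join Es" "Q \<subseteq> ann_Join Es" "R \<subseteq> ann_Join Es"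
    and Es: "\<And>E. E \<in> Es \<Longrightarrow> annihilator_ideal E"
    and law: "\<And>E. E \<in> Es \<Longrightarrow>
      (E \<inter> P) \<inter> ((E \<inter> Q) \<squnion>\<^sub>a (E \<inter> R)) = (E \<inter> Q) \<squnion>\<^sub>a ((E \<inter> P) \<inter> (E \<inter> R))"
  shows "P \<inter> (Q \<squnion>\<^sub>a R) = Q \<squnion>\<^sub>a (P \<inter> R)"
proof (rule eq_by_cuts[OF _ _ Es])
  have dist: "E \<inter> (X \<inter> Y) = (E \<inter> X) \<inter> (E \<inter> Y)" for E X Y :: "'a set"
    by blast
  show "Q \<squnion>\<^sub>a (P \<inter> R) \<subseteq> ann_Join Es"
    by (rule ann_join_least) (use S in auto)
  show "E \<inter> (P \<inter> (Q \<squnion>\<^sub>a R)) = E \<inter> (Q \<squnion>\<^sub>a (P \<inter> R))" if "E \<in> Es" for E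
    using law[OF that] Es[OF that] A
    by (simp add: ideal_Int_join Int_annihilators dist[of E P])
qed (use A S in \<open>auto intro!: Int_annihilators\<close>)

lemma type_determining_modular: "type_determining modular_anns"
  unfolding modular_anns_def
proof (intro type_determining_local_law impI)
  fix Es and P Q R :: "'a set"
  assume "Q \<subseteq> P" and law: "\<And>E. E \<in> Es \<Longrightarrow> E \<inter> Q \<subseteq> E \<inter> P \<longrightarrow>
      (E \<inter> P) \<inter> ((E \<inter> Q) \<squnion>\<^sub>a (E \<inter> R)) = (E \<inter> Q) \<squnion>\<^sub>a ((E \<inter> P) \<inter> (E \<inter> R))"
    and *: "P \<in> annihilators" "Q \<in> annihilators" "R \<in> annihilators"
      "P \<subseteq> ann_Join Es" "Q \<subseteq> ann_Join Es" "R \<subseteq> ann_Join Es"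
      "\<And>E. E \<in> Es \<Longrightarrow> annihilator_ideal E"
  show "P \<inter> (Q \<squnion>\<^sub>a R) = Q \<squnion>\<^sub>a (P \<inter> R)"
    by (rule modular_law_local[OF *]) (use law \<open>Q \<subseteq> P\<close> in blast)+
qed

lemma type_determining_orthomodular: "type_determining orthomodular_anns"
  unfolding orthomodular_anns_def
proof (intro type_determining_local_law impI)
  fix Es and P Q R :: "'a set"
  assume QP: "Q \<subseteq> P \<and> orthogonal_ann Q R" and law: "\<And>E. E \<in> Es \<Longrightarrow>
      E \<inter> Q \<subseteq> E \<inter> P \<and> orthogonal_ann (E \<inter> Q) (E \<inter> R) \<longrightarrow>
      (E \<inter> P) \<inter> ((E \<inter> Q) \<squnion>\<^sub>a (E \<inter> R)) = (E \<inter> Q) \<squnion>\<^sub>a ((E \<inter> P) \<inter> (E \<inter> R))"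
    and *: "P \<in> annihilators" "Q \<in> annihilators" "R \<in> annihilators"
      "P \<subseteq> ann_Join Es" "Q \<subseteq> ann_Join Es" "R \<subseteq> ann_Join Es"
      "\<And>E. E \<in> Es \<Longrightarrow> annihilator_ideal E"
  have "E \<inter> Q \<subseteq> E \<inter> P \<and> orthogonal_ann (E \<inter> Q) (E \<inter> R)" for E
    using QP ann_antimono[of "E \<inter> R" R] unfolding orthogonal_ann_def by blast
  then show "P \<inter> (Q \<squnion>\<^sub>a R) = Q \<squnion>\<^sub>a (P \<inter> R)"
    by (intro modular_law_local[OF *]) (use law in blast)+
qed

lemma distributive_subset_modular: "distributive_anns \<subseteq> modular_anns"
proof
  fix B :: "'a set" assume B: "B \<in> distributive_anns"
  have "P \<inter> (Q \<squnion>\<^sub>a R) = Q \<squnion>\<^sub>a (P \<inter> R)"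
    if "P \<in> ann_below B" "Q \<in> ann_below B" "R \<in> ann_below B" "Q \<subseteq> P" for P Q R
  proof -
    have "P \<inter> (Q \<squnion>\<^sub>a R) = (P \<inter> Q) \<squnion>\<^sub>a (P \<inter> R)"
      using B that unfolding distributive_anns_def by blast
    moreover have "P \<inter> Q = Q"
      using that(4) by blast
    ultimately show ?thesis
      by simp
  qed
  then show "B \<in> modular_anns"
    using B by (simp add: modular_anns_def distributive_anns_def)
qed

lemma modular_subset_orthomodular: "modular_anns \<subseteq> orthomodular_anns"
  unfolding modular_anns_def orthomodular_anns_def by blast

section \<open>The type decomposition\<close>

lemma orthogonal_ann_mult:
  assumes "B \<in> annihilators" "C \<in> annihilators" "orthogonal_ann B C" "b \<in> B" "c \<in> C"
  shows "b * c = 0"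
  using annihilator_mult_ann(2)[OF assms(2,5), of b] assms(3,4) by (auto simp: orthogonal_ann_def)

text \<open>A summand is determined by the sum, since \<open>u\<^sup>* u = - u\<^sup>* v = 0\<close> if \<open>u + v = 0\<close> with
  \<open>u\<close> orthogonal to \<open>v\<close>.\<close>

lemma orthogonal_summand_zero:
  assumes "B \<in> annihilators" "u \<in> B" "u + v = 0" "\<And>b. b \<in> B \<Longrightarrow> b * v = 0"
  shows "u = 0"
proof -
  have "adj u * u + adj u * v = 0"
    using assms(3) by (simp flip: distrib_left)
  then have "adj u * u = 0"
    using assms(4)[OF annihilator_adj[OF assms(1,2)]] by simp
  then show ?thesis
    by simp
qed

lemma ideal_set_plus:
  assumes "ideal I" "ideal J"
  shows "ideal {x + y |x y. x \<in> I \<and> y \<in> J}"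
  unfolding ideal_def
proof (intro conjI ballI allI)
  let ?S = "{x + y |x y. x \<in> I \<and> y \<in> J}"
  have SI: "x + y \<in> ?S" if "x \<in> I" "y \<in> J" for x y
    using that by blast
  note I = assms(1)[unfolded ideal_def] and J = assms(2)[unfolded ideal_def]
  show "0 \<in> ?S"
    using SI[of 0 0] I J by simp
  fix u assume "u \<in> ?S"
  then obtain x y where u: "u = x + y" "x \<in> I" "y \<in> J"
    by blast
  show "z *\<^sub>C u \<in> ?S" for z
    unfolding u(1) scaleC_add_right by (rule SI) (use I J u in auto)
  show "a * u \<in> ?S" "u * a \<in> ?S" for a
    unfolding u(1) distrib_left distrib_right by (rule SI; use I J u in auto)+
  fix v assume "v \<in> ?S"
  then obtain x' y' where v: "v = x' + y'" "x' \<in> I" "y' \<in> J"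
    by blast
  have "u + v = (x + x') + (y + y')"
    unfolding u(1) v(1) by (simp add: algebra_simps)
  also have "\<dots> \<in> ?S"
    by (rule SI) (use I J u v in auto)
  finally show "u + v \<in> ?S" .
qed

theorem theorem1p1:
  fixes A1 A2 A3 A4 :: "'a::cstar_algebra set"
  assumes "A1 = type_ann distributive_anns"
    and "A2 = ann (type_ann distributive_anns) \<inter> type_ann modular_anns"
    and "A3 = ann (type_ann modular_anns) \<inter> type_ann orthomodular_anns"
    and "A4 = ann (type_ann orthomodular_anns)"
  shows "annihilator_ideal A1 \<and> annihilator_ideal A2 \<and> annihilator_ideal A3 \<and> annihilator_ideal A4
    \<and> orthogonal_ann A1 A2 \<and> orthogonal_ann A1 A3 \<and> orthogonal_ann A1 A4
    \<and> orthogonal_ann A2 A3 \<and> orthogonal_ann A2 A4 \<and> orthogonal_ann A3 A4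
    \<and> inj_on (\<lambda>(a, b, c, d). a + b + c + d) (A1 \<times> A2 \<times> A3 \<times> A4)
    \<and> ideal {a + b + c + d |a b c d. a \<in> A1 \<and> b \<in> A2 \<and> c \<in> A3 \<and> d \<in> A4}
    \<and> essential {a + b + c + d |a b c d. a \<in> A1 \<and> b \<in> A2 \<and> c \<in> A3 \<and> d \<in> A4}"
proof -
  let ?S = "{a + b + c + d |a b c d. a \<in> A1 \<and> b \<in> A2 \<and> c \<in> A3 \<and> d \<in> A4}"
  define QD QM QO where "QD = type_ann (distributive_anns :: 'a set set)"
    and "QM = type_ann (modular_anns :: 'a set set)"
    and "QO = type_ann (orthomodular_anns :: 'a set set)"
  note A_def = assms[folded QD_def QM_def QO_def]
  have D: "annihilator_ideal QD" and M: "annihilator_ideal QM" and O: "annihilator_ideal QO"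
    unfolding QD_def QM_def QO_def
    by (intro type_ann_ideal type_determining_distributive type_determining_modular
        type_determining_orthomodular)+
  have DM: "QD \<subseteq> QM" and MO: "QM \<subseteq> QO"
    unfolding QD_def QM_def QO_def
    by (intro type_ann_mono type_determining_distributive type_determining_modular
        type_determining_orthomodular distributive_subset_modular modular_subset_orthomodular)+
  note DA = annihilator_idealD(1)[OF D] and MA = annihilator_idealD(1)[OF M]
    and OA = annihilator_idealD(1)[OF O]
  have I1: "annihilator_ideal A1" and I2: "annihilator_ideal A2"
    and I3: "annihilator_ideal A3" and I4: "annihilator_ideal A4"
    unfolding A_def by (intro annihilator_ideal_Int annihilator_ideal_ann D M O)+
  note An = annihilator_idealD(1)[OF I1] annihilator_idealD(1)[OF I2]
    annihilator_idealD(1)[OF I3] annihilator_idealD(1)[OF I4]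
  have A2M: "A2 \<subseteq> QM" and A3O: "A3 \<subseteq> QO"
    by (auto simp: A_def)
  \<comment> \<open>Every component lies below one of the three central annihilators, and all later ones below
    the orthocomplement of that one.\<close>
  have orth: "orthogonal_ann X Y"
    if "X \<subseteq> Q" "Y \<subseteq> ann Q'" "Q \<subseteq> Q'" "Q' \<in> annihilators" for X Y Q Q' :: "'a set"
    using ann_antimono[OF that(2)] that(1,3,4) by (auto simp: orthogonal_ann_def)
  have o12: "orthogonal_ann A1 A2"
    by (rule orth[of _ QD _ QD]) (use DA in \<open>auto simp: A_def\<close>)
  have o13: "orthogonal_ann A1 A3"
    by (rule orth[of _ QD _ QM]) (use DM MA in \<open>auto simp: A_def\<close>)
  have o14: "orthogonal_ann A1 A4"
    by (rule orth[of _ QD _ QO]) (use DM MO OA in \<open>auto simp: A_def\<close>)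
  have o23: "orthogonal_ann A2 A3"
    by (rule orth[of _ QM _ QM]) (use MA in \<open>auto simp: A_def\<close>)
  have o24: "orthogonal_ann A2 A4"
    by (rule orth[of _ QM _ QO]) (use MO OA in \<open>auto simp: A_def\<close>)
  have o34: "orthogonal_ann A3 A4"
    by (rule orth[of _ QO _ QO]) (use OA in \<open>auto simp: A_def\<close>)
  have sum_zero: "a = 0 \<and> b = 0 \<and> c = 0 \<and> d = 0"
    if "a \<in> A1" "b \<in> A2" "c \<in> A3" "d \<in> A4" and sum: "a + b + c + d = 0" for a b c d
  proof -
    note m = orthogonal_ann_mult
    have a: "a = 0"
    proof (rule orthogonal_summand_zero[OF An(1) that(1), of "b + c + d"])
      show "x * (b + c + d) = 0" if x: "x \<in> A1" for x
        using m[OF An(1,2) o12 x \<open>b \<in> A2\<close>] m[OF An(1,3) o13 x \<open>c \<in> A3\<close>]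
          m[OF An(1,4) o14 x \<open>d \<in> A4\<close>] by (simp add: distrib_left)
    qed (use sum in \<open>simp add: add.assoc\<close>)
    have b: "b = 0"
    proof (rule orthogonal_summand_zero[OF An(2) that(2), of "c + d"])
      show "x * (c + d) = 0" if x: "x \<in> A2" for x
        using m[OF An(2,3) o23 x \<open>c \<in> A3\<close>] m[OF An(2,4) o24 x \<open>d \<in> A4\<close>]
        by (simp add: distrib_left)
    qed (use sum a in \<open>simp add: add.assoc\<close>)
    have c: "c = 0"
    proof (rule orthogonal_summand_zero[OF An(3) that(3), of d])
      show "x * d = 0" if x: "x \<in> A3" for x
        by (rule m[OF An(3,4) o34 x \<open>d \<in> A4\<close>])
    qed (use sum a b in simp)
    show ?thesis
      using a b c sum by simp
  qed
  have inj: "inj_on (\<lambda>(a, b, c, d). a + b + c + d) (A1 \<times> A2 \<times> A3 \<times> A4)"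
  proof (rule inj_onI)
    fix p q
    assume "p \<in> A1 \<times> A2 \<times> A3 \<times> A4" "q \<in> A1 \<times> A2 \<times> A3 \<times> A4"
      and pq: "(\<lambda>(a, b, c, d). a + b + c + d) p = (\<lambda>(a, b, c, d). a + b + c + d) q"
    then obtain a b c d a' b' c' d' where p: "p = (a, b, c, d)" and q: "q = (a', b', c', d')" and *: "a \<in> A1" "b \<in> A2" "c \<in> A3" "d \<in> A4" "a' \<in> A1" "b' \<in> A2" "c' \<in> A3" "d' \<in> A4"
      by blast
    have diff: "x - y \<in> X" if "X \<in> annihilators" "x \<in> X" "y \<in> X" for x y and X :: "'a set"
      using annihilator_add[OF that(1,2) annihilator_minus[OF that(1,3)]] by simp
    have "(a - a') + (b - b') + (c - c') + (d - d') = 0"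
      using pq by (simp add: p q algebra_simps)
    then have "a - a' = 0 \<and> b - b' = 0 \<and> c - c' = 0 \<and> d - d' = 0"
      using * by (intro sum_zero diff An)
    then show "p = q"
      by (simp add: p q)
  qed
  have "ideal A1" "ideal A2" "ideal A3" "ideal A4"
    using I1 I2 I3 I4 by (simp_all add: annihilator_ideal_def)
  then have "ideal {x + d |x d.
      x \<in> {y + c |y c. y \<in> {a + b |a b. a \<in> A1 \<and> b \<in> A2} \<and> c \<in> A3} \<and> d \<in> A4}"
    by (intro ideal_set_plus)
  also have "{x + d |x d.
      x \<in> {y + c |y c. y \<in> {a + b |a b. a \<in> A1 \<and> b \<in> A2} \<and> c \<in> A3} \<and> d \<in> A4} = ?S"
    by blast
  finally have ideal: "ideal ?S" .
  define X where "X = ann ?S"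
  have XA: "X \<in> annihilators"
    by (simp add: X_def)
  have z: "0 \<in> A1" "0 \<in> A2" "0 \<in> A3" "0 \<in> A4"
    using An by (simp_all add: annihilator_zero)
  have S: "a + b + c + d \<in> ?S" if "a \<in> A1" "b \<in> A2" "c \<in> A3" "d \<in> A4" for a b c d
    using that by blast
  have "A1 \<subseteq> ?S" "A2 \<subseteq> ?S" "A3 \<subseteq> ?S" "A4 \<subseteq> ?S"
    using S[OF _ z(2,3,4)] S[OF z(1) _ z(3,4)] S[OF z(1,2) _ z(4)] S[OF z(1,2,3)]
    by (simp_all only: subset_eq add_0_left add_0_right) simp_all
  then have X: "X \<subseteq> ann A1" "X \<subseteq> ann A2" "X \<subseteq> ann A3" "X \<subseteq> ann A4"
    unfolding X_def by (simp_all only: ann_antimono)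
  \<comment> \<open>The complement of the sum meets both \<open>Q\<^sub>M\<close> and its complement trivially: it is
    orthogonal to \<open>Q\<^sub>D\<close> and to \<open>Q\<^sub>D\<^sup>\<perp> \<inter> Q\<^sub>M\<close>, and likewise on the other side.\<close>
  have "X \<subseteq> {0}"
  proof (rule subset_by_two_cuts[OF XA zero_annihilators M])
    have "X \<inter> QM \<subseteq> A2"
      using X(1) by (auto simp: A_def)
    then show "X \<inter> QM \<subseteq> {0}"
      using X(2) annihilator_Int_ann[OF An(2)] by blast
    have "X \<inter> ann QM \<subseteq> A3"
      using X(4) OA by (auto simp: A_def)
    then show "X \<inter> ann QM \<subseteq> {0}"
      using X(3) annihilator_Int_ann[OF An(3)] by blast
  qed
  then have "X = {0}"
    using annihilator_zero[OF XA] by blast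
  then have "essential ?S"
    unfolding essential_def X_def using ann_zero by simp
  then show ?thesis
    using I1 I2 I3 I4 o12 o13 o14 o23 o24 o34 inj ideal by blast
qed

end
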